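(* Let $G$ be a locally compact abelian group with a Haar measure $\mu$, and let $\widehat G$ be its Pontryagin dual group equipped with the dual Haar measure $\nu$. Let $f\in L^1(G)$ be such that $\hat f\in L^1(\widehat G)$. Then \[ \|f\|_1\,\|\hat f\|_1\ \ge\ \|f\|_\infty\,\|\hat f\|_\infty . \]
   Context: $\widehat G$ is the group of continuous homomorphisms $\chi:G\to\mathbb{T}=\{z\in\mathbb{C}:|z|=1\}$ with the compact-open topology. For $f\in L^1(G)$, $\hat f(\chi)=\int_G f(x)\overline{\chi(x)}\,d\mu(x)$. The dual measure $\nu$ is the unique Haar measure on $\widehat G$ for which Fourier inversion holds: $f(x)=\int_{\widehat G}\hat f(\chi)\chi(x)\,d\nu(\chi)$ for $\mu$-a.e. $x$ whenever $f\in L^1(G)$ and $\hat f\in L^1(\widehat G)$. All $L^p$ norms on $G$ are with respect to $\mu$ and on $\widehat G$ with respect to $\nu$ ($\|\cdot\|_\infty$ being the essential supremum). *)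

theory Defs
  imports "HOL-Algebra.Coset" "HOL-Probability.Essential_Supremum"
begin

text \<open>Groups are carrier-based, with a topology whose underlying set is the carrier, so that the
  notion of Haar measure below applies verbatim both to a group and to its dual.\<close>

locale lca_group = comm_group G for G (structure) +
  fixes T :: "'a topology"
  assumes topspace_eq: "topspace T = carrier G"
    and continuous_mult: "continuous_map (prod_topology T T) T (\<lambda>(x, y). x \<otimes> y)"
    and continuous_inv: "continuous_map T T (\<lambda>x. inv x)"
    and Hausdorff: "Hausdorff_space T"
    and locally_compact: "locally_compact_space T"

text \<open>Haar measures are nonzero translation-invariant Radon measures on the Borel
  \<open>\<sigma>\<close>-algebra: finite on compact sets, outer regular on Borel sets, inner regular on open sets.
  No \<open>\<sigma>\<close>-finiteness or second countability is imposed.\<close>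

definition haar_measure ::
    "('a, 'b) monoid_scheme \<Rightarrow> 'a topology \<Rightarrow> 'a measure \<Rightarrow> bool" where
  "haar_measure G T M \<longleftrightarrow>
     sets M = sets (sigma (topspace T) {U. openin T U}) \<and>
     emeasure M (space M) \<noteq> 0 \<and>
     (\<forall>g\<in>carrier G. \<forall>A\<in>sets M. emeasure M (g <#\<^bsub>G\<^esub> A) = emeasure M A) \<and>
     (\<forall>K. compactin T K \<longrightarrow> emeasure M K < \<infinity>) \<and>
     (\<forall>A\<in>sets M. emeasure M A = (INF U\<in>{U. openin T U \<and> A \<subseteq> U}. emeasure M U)) \<and>
     (\<forall>U. openin T U \<longrightarrow> emeasure M U = (SUP K\<in>{K. compactin T K \<and> K \<subseteq> U}. emeasure M K))"

definition circle_group :: "complex monoid" where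
  "circle_group = \<lparr>carrier = sphere 0 1, monoid.mult = (*), one = 1\<rparr>"

text \<open>Characters are made \<open>extensional\<close> (fixed to \<open>undefined\<close> off the carrier), so that equality of
  characters is equality of functions on the group.\<close>

definition characters :: "('a, 'b) monoid_scheme \<Rightarrow> 'a topology \<Rightarrow> ('a \<Rightarrow> complex) set" where
  "characters G T =
     {\<xi> \<in> extensional (carrier G).
        \<xi> \<in> hom G circle_group \<and> continuous_map T (top_of_set (sphere 0 1)) \<xi>}"

definition dual_group ::
    "('a, 'b) monoid_scheme \<Rightarrow> 'a topology \<Rightarrow> ('a \<Rightarrow> complex) monoid" where
  "dual_group G T =
     \<lparr>carrier = characters G T,
      monoid.mult = (\<lambda>\<xi> \<psi>. \<lambda>x\<in>carrier G. \<xi> x * \<psi> x),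
      one = (\<lambda>x\<in>carrier G. 1)\<rparr>"

definition dual_topology ::
    "('a, 'b) monoid_scheme \<Rightarrow> 'a topology \<Rightarrow> ('a \<Rightarrow> complex) topology" where
  "dual_topology G T =
     topology_generated_by
       {{\<xi> \<in> characters G T. \<xi> ` K \<subseteq> U} | K U.
          compactin T K \<and> openin (top_of_set (sphere 0 1)) U}"

lemma topspace_dual_topology: "topspace (dual_topology G T) = carrier (dual_group G T)"
proof -
  have "{\<xi> \<in> characters G T. \<xi> ` {} \<subseteq> {}} \<in>
      {{\<xi> \<in> characters G T. \<xi> ` K \<subseteq> U} | K U.
          compactin T K \<and> openin (top_of_set (sphere 0 1)) U}"
    by (intro CollectI exI[of _ "{}"]) auto
  then show ?thesis
    unfolding dual_topology_def dual_group_def by force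
qed

lemma (in lca_group) comm_group_dual_group: "comm_group (dual_group G T)"
proof (rule comm_groupI)
  have cont: "continuous_map T (top_of_set (sphere 0 1)) f \<longleftrightarrow>
      continuous_map T euclidean f \<and> (\<forall>x\<in>carrier G. norm (f x) = 1)" for f :: "'a \<Rightarrow> complex"
    by (auto simp: continuous_map_in_subtopology topspace_eq)
  have char: "\<xi> \<in> characters G T \<longleftrightarrow> \<xi> \<in> extensional (carrier G) \<and>
      (\<forall>x\<in>carrier G. norm (\<xi> x) = 1) \<and>
      (\<forall>x\<in>carrier G. \<forall>y\<in>carrier G. \<xi> (x \<otimes> y) = \<xi> x * \<xi> y) \<and>
      continuous_map T euclidean \<xi>" for \<xi>
    unfolding characters_def hom_def circle_group_def cont by auto
  have restr: "continuous_map T euclidean (\<lambda>x\<in>carrier G. f x)"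
    if "continuous_map T euclidean f" for f :: "'a \<Rightarrow> complex"
    using that by (rule continuous_map_eq) (auto simp: topspace_eq)
  fix \<xi> \<psi> \<phi>
  show "\<one>\<^bsub>dual_group G T\<^esub> \<in> carrier (dual_group G T)"
    using restr[of "\<lambda>_. 1"] by (simp add: dual_group_def char)
  assume \<xi>: "\<xi> \<in> carrier (dual_group G T)"
  show "\<one>\<^bsub>dual_group G T\<^esub> \<otimes>\<^bsub>dual_group G T\<^esub> \<xi> = \<xi>"
    using \<xi> by (auto simp: dual_group_def char extensional_def restrict_def)
  show "\<exists>\<psi>\<in>carrier (dual_group G T). \<psi> \<otimes>\<^bsub>dual_group G T\<^esub> \<xi> = \<one>\<^bsub>dual_group G T\<^esub>"
  proof
    have "continuous_map T euclidean (\<lambda>x. cnj (\<xi> x))"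
      using \<xi> continuous_map_compose[of T euclidean \<xi> euclidean cnj]
      by (simp add: dual_group_def char o_def continuous_on_cnj)
    then show "(\<lambda>x\<in>carrier G. cnj (\<xi> x)) \<in> carrier (dual_group G T)"
      using \<xi> restr by (simp add: dual_group_def char)
    show "(\<lambda>x\<in>carrier G. cnj (\<xi> x)) \<otimes>\<^bsub>dual_group G T\<^esub> \<xi> = \<one>\<^bsub>dual_group G T\<^esub>"
      using \<xi> by (auto simp: dual_group_def char restrict_def mult.commute[of "cnj _"]
          simp flip: complex_norm_square)
  qed
  assume \<psi>: "\<psi> \<in> carrier (dual_group G T)"
  show "\<xi> \<otimes>\<^bsub>dual_group G T\<^esub> \<psi> \<in> carrier (dual_group G T)"
    using \<xi> \<psi> restr[of "\<lambda>x. \<xi> x * \<psi> x"]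
    by (simp add: dual_group_def char norm_mult continuous_map_atin tendsto_mult)
  show "\<xi> \<otimes>\<^bsub>dual_group G T\<^esub> \<psi> = \<psi> \<otimes>\<^bsub>dual_group G T\<^esub> \<xi>"
    by (simp add: dual_group_def mult.commute)
  show "\<xi> \<otimes>\<^bsub>dual_group G T\<^esub> \<psi> \<otimes>\<^bsub>dual_group G T\<^esub> \<phi> =
      \<xi> \<otimes>\<^bsub>dual_group G T\<^esub> (\<psi> \<otimes>\<^bsub>dual_group G T\<^esub> \<phi>)"
    by (simp add: dual_group_def restrict_def mult.assoc cong: if_cong)
qed

definition fourier_transform :: "'a measure \<Rightarrow> ('a \<Rightarrow> complex) \<Rightarrow> ('a \<Rightarrow> complex) \<Rightarrow> complex" where
  "fourier_transform \<mu> f \<xi> = (\<integral>x. f x * cnj (\<xi> x) \<partial>\<mu>)"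

text \<open>This determines \<open>\<nu>\<close> uniquely: Haar measures on the dual agree up to a positive factor, and the
  inversion formula fixes that factor.\<close>

definition dual_haar_measure ::
    "('a, 'b) monoid_scheme \<Rightarrow> 'a topology \<Rightarrow> 'a measure \<Rightarrow> ('a \<Rightarrow> complex) measure \<Rightarrow> bool" where
  "dual_haar_measure G T \<mu> \<nu> \<longleftrightarrow>
     haar_measure (dual_group G T) (dual_topology G T) \<nu> \<and>
     (\<forall>f. integrable \<mu> f \<longrightarrow> integrable \<nu> (fourier_transform \<mu> f) \<longrightarrow>
        (AE x in \<mu>. f x = (\<integral>\<xi>. fourier_transform \<mu> f \<xi> * \<xi> x \<partial>\<nu>)))"

definition L1_norm :: "'a measure \<Rightarrow> ('a \<Rightarrow> complex) \<Rightarrow> ennreal" where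
  "L1_norm M f = (\<integral>\<^sup>+x. ennreal (norm (f x)) \<partial>M)"

definition Linf_norm :: "'a measure \<Rightarrow> ('a \<Rightarrow> complex) \<Rightarrow> ennreal" where
  "Linf_norm M f = esssup M (\<lambda>x. ennreal (norm (f x)))"

end

theory Submission
  imports Defs
begin

text \<open>Write \<open>F\<close> for the Fourier transform of \<open>f\<close>. Characters have modulus one, so an integral of a
  function against a character is bounded by the \<open>L\<^sup>1\<close> norm of that function. Applied to the
  definition of \<open>F\<close>, this bounds the \<open>L\<^sup>\<infinity>\<close> norm of \<open>F\<close> by the \<open>L\<^sup>1\<close> norm of \<open>f\<close>. Fourier
  inversion represents \<open>f x\<close>, for almost every \<open>x\<close>, as an integral of \<open>F\<close> against evaluation at \<open>x\<close>,
  which also has modulus one; so the \<open>L\<^sup>\<infinity>\<close> norm of \<open>f\<close> is at most the \<open>L\<^sup>1\<close> norm of \<open>F\<close>. The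
  theorem is the product of these two bounds, both of which come from the lemma
  \<open>norm_integral_mult_unimodular_le_L1_norm\<close>.\<close>

text \<open>A product \<open>f k\<close> that fails to be integrable has Bochner integral \<open>0\<close> by convention, so the bound
  persists in that case. This lets the lemma apply to evaluation at a point of the group, as a
  function of the character, without a check of its measurability.\<close>

lemma norm_integral_mult_unimodular_le_L1_norm:
  assumes "\<And>x. x \<in> space M \<Longrightarrow> norm (k x) = 1"
  shows "ennreal (norm (\<integral>x. f x * k x \<partial>M)) \<le> L1_norm M f"
proof (cases "integrable M (\<lambda>x. f x * k x)")
  case True
  then have "ennreal (norm (\<integral>x. f x * k x \<partial>M)) \<le> (\<integral>\<^sup>+x. ennreal (norm (f x * k x)) \<partial>M)"
    by (rule integral_norm_bound_ennreal)
  also have "\<dots> = L1_norm M f"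
    unfolding L1_norm_def by (intro nn_integral_cong) (simp add: norm_mult assms)
  finally show ?thesis .
next
  case False
  then show ?thesis by (simp add: not_integrable_integral_eq)
qed

lemma Linf_norm_le:
  assumes "f \<in> borel_measurable M" "AE x in M. ennreal (norm (f x)) \<le> c"
  shows "Linf_norm M f \<le> c"
  unfolding Linf_norm_def using assms by (intro esssup_I) auto

lemma space_haar_measure:
  assumes "haar_measure G T M"
  shows "space M = topspace T"
proof -
  have "sets M = sets (sigma (topspace T) {U. openin T U})"
    using assms by (simp add: haar_measure_def)
  then show ?thesis
    by (auto dest!: sets_eq_imp_space_eq simp: space_measure_of_conv)
qed

lemma norm_character:
  assumes "\<xi> \<in> characters G T" "x \<in> carrier G"
  shows "norm (\<xi> x) = 1"
  using assms by (auto simp: characters_def circle_group_def hom_def)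

theorem theorem4p1:
  fixes G :: "('a, 'b) monoid_scheme"
    and T :: "'a topology"
    and \<mu> :: "'a measure"
    and \<nu> :: "('a \<Rightarrow> complex) measure"
    and f :: "'a \<Rightarrow> complex"
  assumes "lca_group G T"
    and "haar_measure G T \<mu>"
    and "dual_haar_measure G T \<mu> \<nu>"
    and "integrable \<mu> f"
    and "integrable \<nu> (fourier_transform \<mu> f)"
  shows "L1_norm \<mu> f * L1_norm \<nu> (fourier_transform \<mu> f)
       \<ge> Linf_norm \<mu> f * Linf_norm \<nu> (fourier_transform \<mu> f)"
proof -
  have space_\<mu>: "space \<mu> = carrier G"
    using space_haar_measure[OF assms(2)] lca_group.topspace_eq[OF assms(1)] by simp
  have "haar_measure (dual_group G T) (dual_topology G T) \<nu>"
    using assms(3) by (simp add: dual_haar_measure_def)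
  from space_haar_measure[OF this] have space_\<nu>: "space \<nu> = characters G T"
    by (simp add: topspace_dual_topology dual_group_def)
  have unimodular: "norm (\<xi> x) = 1" if "\<xi> \<in> space \<nu>" "x \<in> space \<mu>" for \<xi> x
    using that norm_character by (simp add: space_\<mu> space_\<nu>)
  have inversion: "AE x in \<mu>. f x = (\<integral>\<xi>. fourier_transform \<mu> f \<xi> * \<xi> x \<partial>\<nu>)"
    using assms by (simp add: dual_haar_measure_def)
  have "Linf_norm \<nu> (fourier_transform \<mu> f) \<le> L1_norm \<mu> f"
  proof (rule Linf_norm_le)
    show "fourier_transform \<mu> f \<in> borel_measurable \<nu>"
      using assms(5) by (rule borel_measurable_integrable)
    show "AE \<xi> in \<nu>. ennreal (norm (fourier_transform \<mu> f \<xi>)) \<le> L1_norm \<mu> f"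
      unfolding fourier_transform_def
      by (intro AE_I2 norm_integral_mult_unimodular_le_L1_norm) (simp add: unimodular)
  qed
  moreover have "Linf_norm \<mu> f \<le> L1_norm \<nu> (fourier_transform \<mu> f)"
  proof (rule Linf_norm_le)
    show "f \<in> borel_measurable \<mu>"
      using assms(4) by (rule borel_measurable_integrable)
    show "AE x in \<mu>. ennreal (norm (f x)) \<le> L1_norm \<nu> (fourier_transform \<mu> f)"
      using inversion AE_space
    proof eventually_elim
      case (elim x)
      have "ennreal (norm (\<integral>\<xi>. fourier_transform \<mu> f \<xi> * \<xi> x \<partial>\<nu>))
          \<le> L1_norm \<nu> (fourier_transform \<mu> f)"
        using elim(2) by (intro norm_integral_mult_unimodular_le_L1_norm unimodular)
      then show ?case by (simp flip: elim(1))
    qed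
  qed
  ultimately show ?thesis
    by (subst mult.commute) (intro mult_mono, simp_all)
qed

end
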